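(* Let $p_1,p_2$ be positive integers. Then there are only finitely many formal baskets ${\bf B}=(B,\tilde{P}_{-1})$ with $(\tilde{P}_{-1}({\bf B}),\tilde{P}_{-2}({\bf B}))=(p_1,p_2)$ such that $B=\{(b_i,r_i)\mid i=1,\dots,t\}$ satisfies $$\gamma(B):=\sum_{i=1}^t\frac{1}{r_i}-\sum_{i=1}^t r_i+24\geq 0.$$
   Context: A basket is a finite collection (with multiplicities allowed) $B=\{(b_i,r_i)\mid i=1,\dots,t\}$ of pairs of integers with $0<b_i\leq r_i/2$ and $b_i$ coprime to $r_i$. Set $\sigma(B)=\sum_i b_i$. A formal basket is a pair ${\bf B}=(B,\tilde{P}_{-1})$ consisting of a basket $B$ and a non-negative integer $\tilde{P}_{-1}$. One defines $\tilde{P}_{-1}({\bf B})=\tilde{P}_{-1}$ and $\tilde{P}_{-2}({\bf B})=5\tilde{P}_{-1}+\sigma(B)-10$. *)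

theory Defs
  imports Complex_Main "HOL-Library.Multiset"
begin

text \<open>Multisets are finite by construction and count repeated pairs, so they render finite
  collections with multiplicities; the order of the members of a basket plays no role.\<close>

type_synonym pairs = "(int \<times> int) multiset"

definition is_basket :: "pairs \<Rightarrow> bool" where
  "is_basket B \<longleftrightarrow>
    (\<forall>(b, r) \<in># B. 0 < b \<and> real_of_int b \<le> real_of_int r / 2 \<and> coprime b r)"

definition sigma :: "pairs \<Rightarrow> int" where
  "sigma B = (\<Sum>(b, r) \<in># B. b)"

definition gamma :: "pairs \<Rightarrow> real" where
  "gamma B = (\<Sum>(b, r) \<in># B. 1 / real_of_int r) - (\<Sum>(b, r) \<in># B. real_of_int r) + 24"

type_synonym formal_pair = "pairs \<times> int"

definition is_formal_basket :: "formal_pair \<Rightarrow> bool" where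
  "is_formal_basket \<B> \<longleftrightarrow> is_basket (fst \<B>) \<and> 0 \<le> snd \<B>"

text \<open>The numbers \<open>P1\<close> and \<open>P2\<close> are the invariants written with a tilde and index
  -1 and -2, respectively.\<close>

definition P1 :: "formal_pair \<Rightarrow> int" where
  "P1 \<B> = snd \<B>"

definition P2 :: "formal_pair \<Rightarrow> int" where
  "P2 \<B> = 5 * snd \<B> + sigma (fst \<B>) - 10"

end

theory Submission
  imports Defs
begin

text \<open>Every pair of a basket has \<open>r \<ge> 2\<close>, so that \<open>r - 1/r \<ge> r/2\<close>. The inequality
  \<open>\<gamma>(B) \<ge> 0\<close> says that the numbers \<open>r - 1/r\<close> add up to at most 24; hence the indices \<open>r\<close>
  add up to at most 48. This bounds both the number of pairs and every entry of a pair, because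
  each index contributes at least 1 and \<open>b \<le> r/2\<close>. So \<open>B\<close> is a multiset of bounded size
  over a finite set, and the second component of the formal basket is prescribed.\<close>

lemma finite_msets_size_le:
  assumes "finite A"
  shows "finite {M. set_mset M \<subseteq> A \<and> size M \<le> n}"
proof (rule finite_subset)
  show "{M. set_mset M \<subseteq> A \<and> size M \<le> n} \<subseteq> mset ` {xs. set xs \<subseteq> A \<and> length xs \<le> n}"
  proof
    fix M assume M: "M \<in> {M. set_mset M \<subseteq> A \<and> size M \<le> n}"
    obtain xs where "mset xs = M"
      using ex_mset by blast
    with M show "M \<in> mset ` {xs. set xs \<subseteq> A \<and> length xs \<le> n}"
      by auto
  qed
  show "finite (mset ` {xs. set xs \<subseteq> A \<and> length xs \<le> n})"
    using finite_lists_length_le[OF assms] by blast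
qed

lemma size_le_sum_mset:
  fixes w :: "'a \<Rightarrow> int"
  assumes "\<And>x. x \<in># M \<Longrightarrow> 1 \<le> w x"
  shows "int (size M) \<le> (\<Sum>x\<in>#M. w x)"
  using assms by (induction M) force+

lemma member_le_sum_mset:
  fixes w :: "'a \<Rightarrow> int"
  assumes "x \<in># M" and "\<And>y. y \<in># M \<Longrightarrow> 0 \<le> w y"
  shows "w x \<le> (\<Sum>y\<in>#M. w y)"
proof -
  obtain N where N: "M = add_mset x N"
    using assms(1) by (metis multi_member_split)
  have "0 \<le> (\<Sum>y\<in>#N. w y)"
    using assms(2) unfolding N by (induction N) (simp, force)
  then show ?thesis
    using N by simp
qed

lemma is_basket_member:
  assumes "is_basket B" and "p \<in># B"
  shows "0 < fst p" and "2 * fst p \<le> snd p"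
proof -
  obtain b r where p: "p = (b, r)"
    by (cases p)
  have "0 < b" and "real_of_int b \<le> real_of_int r / 2"
    using assms unfolding is_basket_def p by auto
  then show "0 < fst p" and "2 * fst p \<le> snd p"
    unfolding p by simp_all
qed

text \<open>The constant 48 comes from \<open>r - 1/r \<ge> r/2\<close>, valid for \<open>r \<ge> 2\<close>: half the sum of the
  indices is at most \<open>24 - \<gamma>(B)\<close>.\<close>

lemma sum_indices_le:
  assumes B: "is_basket B" and "gamma B \<ge> 0"
  shows "(\<Sum>p\<in>#B. snd p) \<le> 48"
proof -
  have half: "real_of_int (snd p) / 2 \<le> real_of_int (snd p) - 1 / real_of_int (snd p)"
    if "p \<in># B" for p
  proof -
    have r: "2 \<le> real_of_int (snd p)"
      using is_basket_member[OF B that] by linarith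
    then have "1 / real_of_int (snd p) \<le> 1 / 2"
      by (intro divide_left_mono) auto
    with r show ?thesis by linarith
  qed
  have "gamma B = 24 - (\<Sum>p\<in>#B. real_of_int (snd p) - 1 / real_of_int (snd p))"
    unfolding gamma_def by (induction B) (auto simp: case_prod_unfold)
  then have "(\<Sum>p\<in>#B. real_of_int (snd p) - 1 / real_of_int (snd p)) \<le> 24"
    using assms(2) by linarith
  moreover have "(\<Sum>p\<in>#B. real_of_int (snd p) / 2)
      \<le> (\<Sum>p\<in>#B. real_of_int (snd p) - 1 / real_of_int (snd p))"
    using half by (rule sum_mset_mono)
  moreover have "(\<Sum>p\<in>#B. real_of_int (snd p) / 2) = real_of_int (\<Sum>p\<in>#B. snd p) / 2"
    by (induction B) (auto simp: add_divide_distrib)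
  ultimately show ?thesis by linarith
qed

lemma finite_baskets_gamma_nonneg:
  "finite {B. is_basket B \<and> gamma B \<ge> 0}"
proof (rule finite_subset)
  show "{B. is_basket B \<and> gamma B \<ge> 0}
      \<subseteq> {B. set_mset B \<subseteq> {1..48} \<times> {1..48} \<and> size B \<le> 48}"
  proof safe
    fix B assume B: "is_basket B" "0 \<le> gamma B"
    have index: "1 \<le> snd p" if "p \<in># B" for p
      using is_basket_member[OF B(1) that] by linarith
    show "size B \<le> 48"
      using size_le_sum_mset[of B snd] index sum_indices_le[OF B] by force
    fix b r assume p: "(b, r) \<in># B"
    have "r \<le> 48"
      using member_le_sum_mset[OF p, of snd] index sum_indices_le[OF B] by force
    then show "b \<in> {1..48}" "r \<in> {1..48}"
      using is_basket_member[OF B(1) p] by auto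
  qed
  show "finite {B :: pairs. set_mset B \<subseteq> {1..48} \<times> {1..48} \<and> size B \<le> 48}"
    by (intro finite_msets_size_le) auto
qed

theorem proposition3p3:
  fixes p\<^sub>1 p\<^sub>2 :: int
  assumes "p\<^sub>1 > 0" and "p\<^sub>2 > 0"
  shows "finite {\<B>. is_formal_basket \<B> \<and> (P1 \<B>, P2 \<B>) = (p\<^sub>1, p\<^sub>2) \<and> gamma (fst \<B>) \<ge> 0}"
proof (rule finite_subset)
  show "{\<B>. is_formal_basket \<B> \<and> (P1 \<B>, P2 \<B>) = (p\<^sub>1, p\<^sub>2) \<and> gamma (fst \<B>) \<ge> 0}
      \<subseteq> {B. is_basket B \<and> gamma B \<ge> 0} \<times> {p\<^sub>1}"
    by (auto simp: is_formal_basket_def P1_def)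
  show "finite ({B. is_basket B \<and> gamma B \<ge> 0} \<times> {p\<^sub>1})"
    using finite_baskets_gamma_nonneg by simp
qed

end
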